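(* The $q$-Chebyshev polynomials of the first kind satisfy, for all integers $n\ge 2$, $$T_n(x,s,q)=(1+q^{n-1})\,x\,T_{n-1}(x,s,q)+q^{n-1}s\,T_{n-2}(x,s,q),$$ with initial values $T_0(x,s,q)=1$ and $T_1(x,s,q)=x$.
   Context: Here $x,s,q$ are indeterminates. Notation: $(a;q)_n=\prod_{j=0}^{n-1}(1-q^ja)$; $\begin{bmatrix} n\\k\end{bmatrix}=\frac{(q;q)_n}{(q;q)_k(q;q)_{n-k}}$ for $0\le k\le n$; $[n]=\frac{1-q^n}{1-q}$. The $q$-Chebyshev polynomials of the first kind are $T_0(x,s,q)=1$ and, for $n>0$, $$T_n(x,s,q)=\sum_{k=0}^{\lfloor n/2\rfloor}q^{k^2}\frac{[n]}{[n-k]}\begin{bmatrix} n-k\\k\end{bmatrix}\frac{(-q;q)_{n-1}}{(-q;q)_k\,(-q^{n-k};q)_k}\,s^kx^{n-2k}.$$ *)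

theory Defs
  imports "HOL-Computational_Algebra.Polynomial" "HOL-Computational_Algebra.Fraction_Field"
begin

definition qpoch :: "'a::comm_ring_1 \<Rightarrow> 'a \<Rightarrow> nat \<Rightarrow> 'a" where
  "qpoch a q n = (\<Prod>j<n. 1 - q ^ j * a)"

definition qbinom :: "'a::field \<Rightarrow> nat \<Rightarrow> nat \<Rightarrow> 'a" where
  "qbinom q n k = (if k \<le> n then qpoch q q n / (qpoch q q k * qpoch q q (n - k)) else 0)"

definition qnum :: "'a::field \<Rightarrow> nat \<Rightarrow> 'a" where
  "qnum q n = (1 - q ^ n) / (1 - q)"

text \<open>
  The indeterminate \<open>q\<close> generates the field of rational functions \<open>K(q)\<close>
  over an arbitrary field \<open>K\<close>, rendered as \<^typ>\<open>'k::field poly fract\<close>. The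
  \<open>q\<close>-Chebyshev polynomials live in the polynomial ring \<open>K(q)[s][x]\<close>, rendered as
  \<^typ>\<open>'k::field poly fract poly poly\<close>: the inner variable is \<open>s\<close>, the outer one is \<open>x\<close>.
\<close>

definition q_ind :: "'k::field poly fract" where
  "q_ind = Fract [:0, 1:] 1"

definition s_ind :: "'k::field poly fract poly poly" where
  "s_ind = [:[:0, 1:]:]"

definition x_ind :: "'k::field poly fract poly poly" where
  "x_ind = [:0, 1:]"

definition const_Kq :: "'k::field poly fract \<Rightarrow> 'k poly fract poly poly" where
  "const_Kq c = [:[:c:]:]"

definition qcheb_T_coeff :: "'a::field \<Rightarrow> nat \<Rightarrow> nat \<Rightarrow> 'a" where
  "qcheb_T_coeff q n k =
     q ^ (k\<^sup>2) * (qnum q n / qnum q (n - k)) * qbinom q (n - k) k *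
     (qpoch (- q) q (n - 1) / (qpoch (- q) q k * qpoch (- (q ^ (n - k))) q k))"

definition qcheb_T :: "nat \<Rightarrow> 'k::field poly fract poly poly" where
  "qcheb_T n =
     (if n = 0 then 1
      else (\<Sum>k\<le>n div 2. const_Kq (qcheb_T_coeff q_ind n k) * s_ind ^ k * x_ind ^ (n - 2 * k)))"

end

theory Submission
  imports Defs
begin

text \<open>
  Comparing coefficients of \<open>s\<^sup>k x\<^sup>i\<close>, where \<open>i = n - 2 k\<close>, turns the recurrence into a
  Pascal-type rule for the coefficients, so everything rests on a manageable form of these. Two
  simplifications give it. First, \<open>(-q\<^bsup>n-k\<^esup>; q)\<^sub>k\<close> is the tail of \<open>(-q; q)\<^bsub>n-1\<^esub>\<close>, so the last
  fraction of the coefficient is \<open>(-q; q)\<^bsub>n-k-1\<^esub> / (-q; q)\<^sub>k\<close>. Second,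
  \<open>(q; q)\<^sub>j (-q; q)\<^sub>j = (q\<^sup>2; q\<^sup>2)\<^sub>j\<close>. Altogether the coefficient becomes
  \<open>q\<^bsup>k\<^sup>2\<^esup> (1 - q\<^bsup>i + 2k\<^esup>) (q\<^sup>2; q\<^sup>2)\<^bsub>i+k-1\<^esub> / ((q\<^sup>2; q\<^sup>2)\<^sub>k (q; q)\<^sub>i)\<close>
  (lemma \<open>qcheb_T_coeff_closed_form\<close>). After division by the common factors, the Pascal-type rule
  (lemma \<open>qcheb_T_coeff_pascal\<close>) is a polynomial identity in \<open>q\<^sup>i\<close>, \<open>q\<^sup>k\<close> and \<open>q\<close>.

  The only property of \<open>q\<close> that enters is that it is not a root of unity. This also gives
  \<open>q\<^sup>m \<noteq> -1\<close> for \<open>m > 0\<close>, in any characteristic, so all denominators are nonzero.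
\<close>

section \<open>Shifted factorials to the bases \<open>q\<close> and \<open>q\<^sup>2\<close>\<close>

lemma qpoch_0 [simp]: "qpoch a q 0 = 1"
  by (simp add: qpoch_def)

lemma qpoch_Suc: "qpoch a q (Suc n) = qpoch a q n * (1 - q ^ n * a)"
  by (simp add: qpoch_def)

lemma qpoch_add: "qpoch a q (m + n) = qpoch a q m * qpoch (q ^ m * a) q n"
  by (induction n) (simp_all add: qpoch_Suc power_add algebra_simps)

text \<open>Factorwise \<open>(1 - q\<^sup>j a) (1 + q\<^sup>j a) = 1 - (q\<^sup>2)\<^sup>j a\<^sup>2\<close>.\<close>

lemma qpoch_mult_qpoch_uminus: "qpoch a q n * qpoch (- a) q n = qpoch (a\<^sup>2) (q\<^sup>2) n"
  by (simp add: qpoch_def prod.distrib [symmetric] power_mult_distrib power2_eq_square algebra_simps)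

lemma qpoch_square_base_Suc:
  "qpoch (q\<^sup>2) (q\<^sup>2) (Suc n) = qpoch (q\<^sup>2) (q\<^sup>2) n * (1 - q ^ (2 * Suc n))"
  by (simp add: qpoch_Suc power_mult [symmetric] power_add [symmetric] del: power_Suc)

lemma qpoch_self_Suc: "qpoch q q (Suc n) = qpoch q q n * (1 - q ^ Suc n)"
  by (simp add: qpoch_Suc mult.commute)

lemma qpoch_self_nonzero:
  fixes q :: "'a::field"
  assumes "\<And>m. m > 0 \<Longrightarrow> q ^ m \<noteq> 1"
  shows "qpoch q q n \<noteq> 0"
  using assms by (induction n) (simp_all add: qpoch_self_Suc del: power_Suc)

lemma qpoch_square_base_nonzero:
  fixes q :: "'a::field"
  assumes "\<And>m. m > 0 \<Longrightarrow> q ^ m \<noteq> 1"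
  shows "qpoch (q\<^sup>2) (q\<^sup>2) n \<noteq> 0"
  using assms by (induction n) (simp_all add: qpoch_square_base_Suc del: power_Suc mult_Suc_right)

section \<open>The coefficients and their Pascal-type rule\<close>

text \<open>
  Writing \<open>r = n - k - 1\<close> with \<open>n = i + 2 k\<close>, the factor \<open>[n - k]\<close> removes the last factor of
  \<open>(q; q)\<^bsub>n-k\<^esub>\<close> in the \<open>q\<close>-binomial coefficient, which leaves \<open>(q; q)\<^sub>r\<close>. It pairs with the
  \<open>(-q; q)\<^sub>r\<close> that remains of \<open>(-q; q)\<^bsub>n-1\<^esub>\<close>.
\<close>

lemma qcheb_T_coeff_closed_form:
  fixes q :: "'a::field"
  assumes q: "\<And>m. m > 0 \<Longrightarrow> q ^ m \<noteq> 1" and "i + k = Suc r"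
  shows "qcheb_T_coeff q (i + 2 * k) k =
    q ^ k\<^sup>2 * (1 - q ^ (i + 2 * k)) * qpoch (q\<^sup>2) (q\<^sup>2) r / (qpoch (q\<^sup>2) (q\<^sup>2) k * qpoch q q i)"
proof -
  define A where "A = qpoch q q"
  define B where "B = qpoch (- q) q"
  have A_nz: "A j \<noteq> 0" for j
    unfolding A_def using qpoch_self_nonzero [OF q] .
  have AB: "A j * B j = qpoch (q\<^sup>2) (q\<^sup>2) j" for j
    by (simp add: A_def B_def qpoch_mult_qpoch_uminus)
  then have B_nz: "B j \<noteq> 0" for j
    using qpoch_square_base_nonzero [OF q] by (metis mult_zero_right)
  have split: "B (r + k) = B r * qpoch (- (q ^ Suc r)) q k"
    by (simp add: B_def qpoch_add mult.commute)
  then have tail_nz: "qpoch (- (q ^ Suc r)) q k \<noteq> 0"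
    using B_nz [of "r + k"] by auto
  have q1: "1 - q \<noteq> 0" and qr: "1 - q ^ Suc r \<noteq> 0"
    using q [of 1] q [of "Suc r"] by auto
  have n: "i + 2 * k = Suc (r + k)" "i + 2 * k - 1 = r + k" "i + 2 * k - k = Suc r" "Suc r - k = i" "k \<le> Suc r"
    using assms(2) by auto
  have "qcheb_T_coeff q (i + 2 * k) k =
      q ^ k\<^sup>2 * (((1 - q ^ (i + 2 * k)) / (1 - q)) / ((1 - q ^ Suc r) / (1 - q))) *
      (A r * (1 - q ^ Suc r) / (A k * A i)) *
      (B r * qpoch (- (q ^ Suc r)) q k / (B k * qpoch (- (q ^ Suc r)) q k))"
    unfolding qcheb_T_coeff_def qnum_def qbinom_def n(2,3,4)
    using n(5) by (simp add: qpoch_self_Suc A_def split flip: B_def del: power_Suc)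
  also have "\<dots> = q ^ k\<^sup>2 * (1 - q ^ (i + 2 * k)) * (A r * B r) / ((A k * B k) * A i)"
    using A_nz [of k] A_nz [of i] B_nz [of k] tail_nz q1 qr by (simp add: divide_simps del: power_Suc)
  finally show ?thesis
    by (simp only: AB) (simp add: A_def)
qed

text \<open>
  The value at \<open>i = k = 0\<close> has to be set apart, since the defining formula there contains the
  undetermined quotient \<open>[0] / [0]\<close>.
\<close>

definition qcheb_T_monom_coeff :: "'a::field \<Rightarrow> nat \<Rightarrow> nat \<Rightarrow> 'a" where
  "qcheb_T_monom_coeff q i k =
     (if i = 0 \<and> k = 0 then 1 else qcheb_T_coeff q (i + 2 * k) k)"

lemma qcheb_T_monom_coeff_closed_form:
  fixes q :: "'a::field"
  assumes "\<And>m. m > 0 \<Longrightarrow> q ^ m \<noteq> 1" and "i + k = Suc r"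
  shows "qcheb_T_monom_coeff q i k =
    q ^ k\<^sup>2 * (1 - q ^ (i + 2 * k)) * qpoch (q\<^sup>2) (q\<^sup>2) r / (qpoch (q\<^sup>2) (q\<^sup>2) k * qpoch q q i)"
  using qcheb_T_coeff_closed_form [OF assms] assms(2) by (auto simp: qcheb_T_monom_coeff_def)

text \<open>
  For \<open>i = 0\<close> the factors \<open>1 - q\<^bsup>2k\<^esup>\<close> cancel. In contrast to the closed form, the result also
  covers \<open>k = 0\<close>, so the special value fits in.
\<close>

lemma qcheb_T_monom_coeff_0:
  fixes q :: "'a::field"
  assumes q: "\<And>m. m > 0 \<Longrightarrow> q ^ m \<noteq> 1"
  shows "qcheb_T_monom_coeff q 0 k = q ^ k\<^sup>2"
proof (cases k)
  case 0
  then show ?thesis by (simp add: qcheb_T_monom_coeff_def)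
next
  case (Suc r)
  then show ?thesis
    using qcheb_T_monom_coeff_closed_form [OF q, of 0 k r] qpoch_square_base_nonzero [OF q, of r] q [of "2 * Suc r"]
    by (simp add: qpoch_square_base_Suc del: power_Suc mult_Suc_right)
qed

text \<open>
  On the boundary \<open>i = 0\<close> or \<open>k = 0\<close> one of the two predecessors is absent and the rule is a
  direct cancellation. The bound \<open>n \<ge> 1\<close> excludes \<open>i = 1\<close>, \<open>k = 0\<close>, where the factor
  \<open>1 + q\<^sup>0\<close> would give \<open>2\<close> instead of \<open>1\<close>.
\<close>

lemma qcheb_T_coeff_pascal:
  fixes q :: "'a::field"
  assumes q: "\<And>m. m > 0 \<Longrightarrow> q ^ m \<noteq> 1" and n: "i + 2 * k = Suc n" "n \<ge> 1"
  shows "qcheb_T_monom_coeff q i k =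
    (1 + q ^ n) * (if i = 0 then 0 else qcheb_T_monom_coeff q (i - 1) k)
    + q ^ n * (if k = 0 then 0 else qcheb_T_monom_coeff q i (k - 1))"
proof -
  define A where "A = qpoch q q"
  define E where "E = qpoch (q\<^sup>2) (q\<^sup>2)"
  have A_Suc: "A (Suc j) = A j * (1 - q ^ Suc j)" for j
    by (simp add: A_def qpoch_self_Suc)
  have E_Suc: "E (Suc j) = E j * (1 - q ^ (2 * Suc j))" for j
    unfolding E_def by (rule qpoch_square_base_Suc)
  have closed: "qcheb_T_monom_coeff q i k = q ^ k\<^sup>2 * (1 - q ^ (i + 2 * k)) * E r / (E k * A i)"
    if "i + k = Suc r" for i k r
    unfolding A_def E_def using qcheb_T_monom_coeff_closed_form [OF q that] .
  have nz: "1 - q ^ Suc j \<noteq> 0" "1 - q ^ (2 * Suc j) \<noteq> 0" for j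
    using q [of "Suc j"] q [of "2 * Suc j"] by auto
  show ?thesis
  proof (cases i)
    case 0
    then obtain k' where k: "k = Suc k'" using n by (cases k) auto
    then have "n + k'\<^sup>2 = k\<^sup>2"
      using n 0 by (simp add: power2_eq_square)
    then show ?thesis
      using 0 k by (simp add: qcheb_T_monom_coeff_0 [OF q] flip: power_add)
  next
    case i: (Suc i')
    show ?thesis
    proof (cases k)
      case 0
      then obtain r where r: "i' = Suc r" using n i by (cases i') auto
      have "n = Suc r" using n i r 0 by simp
      then have n_eq: "i = Suc n" "i' = n" using i r by simp_all
      have "qcheb_T_monom_coeff q i k = (1 - q ^ (2 * n)) * E r / (E 0 * A n)"
        using closed [of i k "Suc r"] n_eq \<open>n = Suc r\<close> 0 nz(1) [of "Suc r"]
        by (simp add: E_Suc A_Suc [of "Suc r"] del: power_Suc mult_Suc_right)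
      moreover have "qcheb_T_monom_coeff q i' k = (1 - q ^ n) * E r / (E 0 * A n)"
        using closed [of i' k r] n_eq \<open>n = Suc r\<close> 0 by simp
      moreover have "1 - q ^ (2 * n) = (1 + q ^ n) * (1 - q ^ n)"
        unfolding mult_2 power_add by (simp add: algebra_simps)
      ultimately show ?thesis
        using i 0 by simp
    next
      case k: (Suc k')
      define r where "r = i' + k'"
      have nn: "n = i' + 2 * k' + 2" using n i k by simp
      have sums: "i + k = Suc (Suc r)" "i' + k = Suc r" "i + k' = Suc r"
        "i' + 2 * k = n" "i + 2 * k' = n - 1"
        using i k nn r_def by simp_all
      have A_i: "A i = A i' * (1 - q ^ i)" and E_k: "E k = E k' * (1 - q ^ (2 * k))"
        unfolding i k by (rule A_Suc, rule E_Suc)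
      have nz_ik: "1 - q ^ i \<noteq> 0" "1 - q ^ (2 * k) \<noteq> 0"
        unfolding i k by (rule nz)+
      \<comment> \<open>The three closed forms over the common denominator \<open>E k * A i\<close>.\<close>
      have 1: "qcheb_T_monom_coeff q i k =
          q ^ k\<^sup>2 * (1 - q ^ Suc n) * E r * (1 - q ^ (2 * Suc r)) / (E k * A i)"
        by (simp only: closed [OF sums(1)] n(1) E_Suc mult.assoc)
      have 2: "qcheb_T_monom_coeff q i' k =
          q ^ k\<^sup>2 * (1 - q ^ n) * E r * (1 - q ^ i) / (E k * A i)"
        unfolding closed [OF sums(2)] sums(4) A_i using nz_ik(1) by simp
      have 3: "qcheb_T_monom_coeff q i k' =
          q ^ k'\<^sup>2 * (1 - q ^ (n - 1)) * E r * (1 - q ^ (2 * k)) / (E k * A i)"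
        unfolding closed [OF sums(3)] sums(5) E_k using nz_ik(2) by simp
      have "n + k'\<^sup>2 = k\<^sup>2 + i"
        using nn i k by (simp add: power2_eq_square)
      then have shift: "q ^ n * q ^ k'\<^sup>2 = q ^ k\<^sup>2 * q ^ i"
        by (simp flip: power_add)
      have key: "(1 - q ^ Suc n) * (1 - q ^ (2 * Suc r)) =
          (1 + q ^ n) * (1 - q ^ n) * (1 - q ^ i) + q ^ i * (1 - q ^ (n - 1)) * (1 - q ^ (2 * k))"
        unfolding nn i k r_def
        by (simp add: power_add power_mult power2_eq_square algebra_simps power_mult_distrib)
      have distrib: "a * e * (b * c * d + x * y * z) / f = b * (a * c * e * d / f) + (a * x) * (y * e * z / f)"
        for a b c d e f x y z :: 'a
        by (simp add: algebra_simps add_divide_distrib)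
      have "qcheb_T_monom_coeff q i k = q ^ k\<^sup>2 * E r *
          ((1 - q ^ Suc n) * (1 - q ^ (2 * Suc r))) / (E k * A i)"
        by (simp only: 1 ac_simps)
      also have "\<dots> = (1 + q ^ n) * qcheb_T_monom_coeff q i' k
          + (q ^ k\<^sup>2 * q ^ i) * ((1 - q ^ (n - 1)) * E r * (1 - q ^ (2 * k)) / (E k * A i))"
        unfolding key 2 by (rule distrib)
      also have "\<dots> = (1 + q ^ n) * qcheb_T_monom_coeff q i' k + q ^ n * qcheb_T_monom_coeff q i k'"
        unfolding 3 shift [symmetric] by (simp only: times_divide_eq_right ac_simps)
      finally show ?thesis using i k by simp
    qed
  qed
qed

section \<open>Comparison of coefficients in \<open>K(q)[s][x]\<close>\<close>

lemma q_ind_power_neq_1: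
  assumes "m > 0"
  shows "(q_ind :: 'k::field poly fract) ^ m \<noteq> 1"
proof -
  have "(q_ind :: 'k poly fract) ^ m = Fract (monom 1 m) 1"
    by (induction m) (simp_all add: q_ind_def One_fract_def monom_Suc)
  moreover have "monom (1 :: 'k) m \<noteq> 1"
    using assms by (metis degree_1 degree_monom_eq less_numeral_extra(3) zero_neq_one)
  ultimately show ?thesis
    by (simp add: One_fract_def eq_fract)
qed

lemma const_Kq_mult_monomials:
  fixes c :: "'k::field poly fract"
  shows "const_Kq c * s_ind ^ k * x_ind ^ i = monom (monom c k) i"
proof -
  have "(s_ind :: 'k poly fract poly poly) ^ k = [:monom 1 k:]"
    by (induction k) (simp_all add: s_ind_def monom_Suc one_pCons)
  moreover have "(x_ind :: 'k poly fract poly poly) ^ i = monom 1 i"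
    by (induction i) (simp_all add: x_ind_def monom_Suc)
  ultimately show ?thesis
    by (simp add: const_Kq_def smult_monom mult.assoc)
qed

lemma coeff_qcheb_T:
  "coeff (coeff (qcheb_T n) i) k = (if i + 2 * k = n then qcheb_T_monom_coeff q_ind i k else 0)"
proof (cases "n = 0")
  case True
  then show ?thesis
    by (cases i; cases k) (simp_all add: qcheb_T_def qcheb_T_monom_coeff_def)
next
  case False
  have "coeff (coeff (qcheb_T n) i) k =
      (\<Sum>l\<le>n div 2. if n - 2 * l = i \<and> l = k then qcheb_T_coeff q_ind n l else 0)"
    using False
    by (auto simp: qcheb_T_def const_Kq_mult_monomials coeff_sum intro!: sum.cong)
  also have "\<dots> = (\<Sum>l\<le>n div 2. if l = k then (if i + 2 * k = n then qcheb_T_coeff q_ind n k else 0) else 0)"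
    by (intro sum.cong) auto
  also have "\<dots> = (if i + 2 * k = n then qcheb_T_coeff q_ind n k else 0)"
    by (simp, arith)
  finally show ?thesis
    using False by (auto simp: qcheb_T_monom_coeff_def)
qed

lemma coeff_const_Kq_x_ind_mult:
  "coeff (coeff (const_Kq c * x_ind * p) i) k = c * (if i = 0 then 0 else coeff (coeff p (i - 1)) k)"
  by (cases i) (simp_all add: const_Kq_def x_ind_def)

lemma coeff_const_Kq_s_ind_mult:
  "coeff (coeff (const_Kq c * s_ind * p) i) k = c * (if k = 0 then 0 else coeff (coeff p i) (k - 1))"
  by (cases k) (simp_all add: const_Kq_def s_ind_def)

theorem theorem5p2:
  "(\<forall>n\<ge>2. (qcheb_T n :: 'k::field poly fract poly poly) =
       const_Kq (1 + q_ind ^ (n - 1)) * x_ind * qcheb_T (n - 1)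
       + const_Kq (q_ind ^ (n - 1)) * s_ind * qcheb_T (n - 2))
   \<and> (qcheb_T 0 :: 'k poly fract poly poly) = 1
   \<and> (qcheb_T 1 :: 'k poly fract poly poly) = x_ind"
proof (intro conjI allI impI)
  fix n :: nat
  assume "n \<ge> 2"
  show "(qcheb_T n :: 'k poly fract poly poly) =
       const_Kq (1 + q_ind ^ (n - 1)) * x_ind * qcheb_T (n - 1)
       + const_Kq (q_ind ^ (n - 1)) * s_ind * qcheb_T (n - 2)" (is "_ = ?R")
  proof (intro poly_eqI)
    fix i k
    have coeff_R: "coeff (coeff ?R i) k =
        (1 + q_ind ^ (n - 1)) * (if i = 0 then 0 else coeff (coeff (qcheb_T (n - 1)) (i - 1)) k)
        + q_ind ^ (n - 1) * (if k = 0 then 0 else coeff (coeff (qcheb_T (n - 2)) i) (k - 1))"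
      by (simp only: coeff_add coeff_const_Kq_x_ind_mult coeff_const_Kq_s_ind_mult)
    show "coeff (coeff (qcheb_T n :: 'k poly fract poly poly) i) k = coeff (coeff ?R i) k"
    proof (cases "i + 2 * k = n")
      case True
      then have "i + 2 * k = Suc (n - 1)" "n - 1 \<ge> 1"
        using \<open>n \<ge> 2\<close> by auto
      from qcheb_T_coeff_pascal [OF q_ind_power_neq_1 this]
      show ?thesis
        unfolding coeff_R coeff_qcheb_T using True by (auto split: if_splits)
    next
      case False
      then have "(if i = 0 then 0 else coeff (coeff (qcheb_T (n - 1) :: 'k poly fract poly poly) (i - 1)) k) = 0"
        and "(if k = 0 then 0 else coeff (coeff (qcheb_T (n - 2) :: 'k poly fract poly poly) i) (k - 1)) = 0"
        using \<open>n \<ge> 2\<close> by (simp_all add: coeff_qcheb_T) linarith+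
      then show ?thesis
        unfolding coeff_R using False by (simp only: coeff_qcheb_T if_False mult_zero_right add_0)
    qed
  qed
next
  show "(qcheb_T 0 :: 'k poly fract poly poly) = 1"
    by (simp add: qcheb_T_def)
next
  have "qcheb_T_coeff (q_ind :: 'k poly fract) 1 0 = 1"
    using q_ind_power_neq_1 [of 1, where 'k = 'k]
    by (simp add: qcheb_T_coeff_def qnum_def qbinom_def qpoch_def)
  then show "(qcheb_T 1 :: 'k poly fract poly poly) = x_ind"
    by (simp add: qcheb_T_def const_Kq_def flip: one_pCons)
qed

end
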